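(* Let $m_1,m_2,\ldots$ be nonnegative integers, $M(z)=\sum_{i\ge1}m_iz^i/i!$, and for $x>0$ let $\lambda_i(x):=m_ix^i/i!$. Let $n\ge k\ge1$ be integers with $p(n,k)>0$, and let $\mathbf D(n,k)=(D_1(n,k),\ldots,D_n(n,k))$ be the vector of component counts ($D_i(n,k)$ = number of components of size $i$) of an $M$-assembly chosen uniformly from the $p(n,k)$ $M$-assemblies of size $n$ having exactly $k$ components; put $D_i(n,k):=0$ for $i>n$. (a) For every $x>0$: let $Y_1,\ldots,Y_k$ be i.i.d. with $$\mathbb P_x(Y_j=i)=\frac{\lambda_i(x)}{\lambda_1(x)+\cdots+\lambda_n(x)},\qquad i\in\{1,\ldots,n\},$$ and let $N_i$ be the number of indices $j\in\{1,\dots,k\}$ with $Y_j=i$. Then $\mathbf D(n,k)$ has the same distribution as $(N_1,\ldots,N_n)$ conditional on the event $Y_1+\cdots+Y_k=n$. (b) For every $x>0$ with $M(x)<\infty$: let $Y_1,\ldots,Y_k$ be i.i.d. with $$\mathbb P_x(Y_j=i)=\frac{\lambda_i(x)}{M(x)},\qquad i\in\{1,2,3,\ldots\},$$ and let $N_i$ be the number of indices $j\in\{1,\dots,k\}$ with $Y_j=i$. Then $(D_1(n,k),D_2(n,k),\ldots)$ has the same distribution as $(N_1,N_2,\ldots)$ conditional on the event $Y_1+\cdots+Y_k=n$.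
   Context: Given nonnegative integers $m_1,m_2,\ldots$ with exponential generating function $M(z)=\sum_{i\ge1}m_iz^i/i!$, an $M$-assembly of size $n$ is obtained by choosing a set partition of $\{1,\dots,n\}$ into nonempty blocks and, for each block of size $i$, choosing one of $m_i$ possible decorations. The decorated blocks are the components; the size of a component is the size of its block. $p(n,k)$ is the number of $M$-assemblies of size $n$ with exactly $k$ components. The number of $M$-assemblies of size $n$ with $a_i$ components of size $i$ ($\sum_i i a_i=n$) is $n!\prod_i \frac{m_i^{a_i}}{a_i!(i!)^{a_i}}$. *)

theory Defs
  imports "HOL-Probability.Probability"
begin

text \<open>
  An assembly of size \<open>n\<close> is a pair \<open>(P, d)\<close> of a set partition \<open>P\<close> of \<open>{1..n}\<close> and a decoration
  \<open>d\<close> of its blocks; the \<open>m i\<close> possible decorations of a block of size \<open>i\<close> are the numbers below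
  \<open>m i\<close>. The value \<open>m 0\<close> is never used.
\<close>

definition assemblies :: "(nat \<Rightarrow> nat) \<Rightarrow> nat \<Rightarrow> (nat set set \<times> (nat set \<Rightarrow> nat)) set" where
  "assemblies m n = (SIGMA P : {P. partition_on {1..n} P}. (\<Pi>\<^sub>E B\<in>P. {..<m (card B)}))"

definition assemblies_with :: "(nat \<Rightarrow> nat) \<Rightarrow> nat \<Rightarrow> nat \<Rightarrow> (nat set set \<times> (nat set \<Rightarrow> nat)) set" where
  "assemblies_with m n k = {a \<in> assemblies m n. card (fst a) = k}"

definition num_assemblies :: "(nat \<Rightarrow> nat) \<Rightarrow> nat \<Rightarrow> nat \<Rightarrow> nat" where
  "num_assemblies m n k = card (assemblies_with m n k)"

definition component_count :: "nat set set \<times> (nat set \<Rightarrow> nat) \<Rightarrow> nat \<Rightarrow> nat" where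
  "component_count a i = card {B \<in> fst a. card B = i}"

lemma component_count_eq_0:
  assumes "a \<in> assemblies m n" "i > n"
  shows "component_count a i = 0"
proof -
  have "card B \<le> n" if "B \<in> fst a" for B
  proof -
    have "B \<subseteq> {1..n}"
      using that assms(1) by (auto simp: assemblies_def partition_on_def)
    then show ?thesis
      using card_mono[of "{1..n}" B] by simp
  qed
  then have "{B \<in> fst a. card B = i} = {}"
    using assms(2) by fastforce
  then show ?thesis
    unfolding component_count_def by (simp only: card.empty)
qed

text \<open>
  The law of the vector \<open>(D i)\<close>, \<open>i \<in> I\<close>, where \<open>D i\<close> is the number of components of size \<open>i\<close> of
  a uniformly chosen assembly. Vectors indexed by \<open>I\<close> are functions that are undefined off \<open>I\<close>.
  The convention that \<open>D i = 0\<close> for \<open>i > n\<close> holds by \<open>component_count_eq_0\<close>.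
\<close>

definition component_law :: "(nat \<Rightarrow> nat) \<Rightarrow> nat \<Rightarrow> nat \<Rightarrow> nat set \<Rightarrow> (nat \<Rightarrow> nat) pmf" where
  "component_law m n k I =
     map_pmf (\<lambda>a. restrict (component_count a) I) (pmf_of_set (assemblies_with m n k))"

definition weight :: "(nat \<Rightarrow> nat) \<Rightarrow> real \<Rightarrow> nat \<Rightarrow> real" where
  "weight m x i = real (m i) * x ^ i / fact i"

text \<open>For \<open>x > 0\<close>, \<open>M(x) < \<infinity>\<close> is \<open>weight m x summable_on {1..}\<close>.\<close>

definition egf :: "(nat \<Rightarrow> nat) \<Rightarrow> real \<Rightarrow> real" where
  "egf m x = (\<Sum>\<^sub>\<infinity>i\<in>{1..}. weight m x i)"

text \<open>
  \<open>Y 1, \<dots>, Y k\<close> are independent and each takes the value \<open>i\<close> with probability \<open>q i\<close> for \<open>i \<in> S\<close>.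
  When \<open>q\<close> sums to 1 over \<open>S\<close> this determines the law, and the values lie in \<open>S\<close> almost surely.
\<close>

definition iid_with :: "'w measure \<Rightarrow> (nat \<Rightarrow> 'w \<Rightarrow> nat) \<Rightarrow> nat \<Rightarrow> nat set \<Rightarrow> (nat \<Rightarrow> real) \<Rightarrow> bool" where
  "iid_with \<Omega> Y k S q \<longleftrightarrow>
     prob_space \<Omega> \<and>
     prob_space.indep_vars \<Omega> (\<lambda>_. count_space UNIV) Y {1..k} \<and>
     (\<forall>j\<in>{1..k}. \<forall>i\<in>S. measure \<Omega> {\<omega> \<in> space \<Omega>. Y j \<omega> = i} = q i)"

definition occurrences :: "(nat \<Rightarrow> 'w \<Rightarrow> nat) \<Rightarrow> nat \<Rightarrow> 'w \<Rightarrow> nat \<Rightarrow> nat" where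
  "occurrences Y k \<omega> i = card {j \<in> {1..k}. Y j \<omega> = i}"

definition sum_event :: "'w measure \<Rightarrow> (nat \<Rightarrow> 'w \<Rightarrow> nat) \<Rightarrow> nat \<Rightarrow> nat \<Rightarrow> 'w set" where
  "sum_event \<Omega> Y k n = {\<omega> \<in> space \<Omega>. (\<Sum>j = 1..k. Y j \<omega>) = n}"

text \<open>
  The law of \<open>(N i)\<close>, \<open>i \<in> I\<close>, conditional on the event that the \<open>Y j\<close> sum to \<open>n\<close>. Only countably
  many vectors occur, so the discrete sigma-algebra is appropriate also for infinite \<open>I\<close>.
\<close>

definition conditional_law ::
  "'w measure \<Rightarrow> (nat \<Rightarrow> 'w \<Rightarrow> nat) \<Rightarrow> nat \<Rightarrow> nat \<Rightarrow> nat set \<Rightarrow> (nat \<Rightarrow> nat) measure" where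
  "conditional_law \<Omega> Y k n I =
     distr (uniform_measure \<Omega> (sum_event \<Omega> Y k n)) (count_space UNIV)
       (\<lambda>\<omega>. restrict (occurrences Y k \<omega>) I)"

end

theory Submission
  imports Defs
begin

text \<open>
  Numbering the \<open>k\<close> blocks of an assembly in all \<open>k!\<close> ways gives ordered set partitions; those with
  block sizes \<open>y 1, \<dots>, y k\<close> number \<open>n! / \<Prod> (y j)!\<close>, each with \<open>\<Prod> m (y j)\<close> decorations. Hence for every
  set \<open>C\<close> of count vectors, \<open>k!\<close> times the number of assemblies with counts in \<open>C\<close> is \<open>n!\<close> times the
  sum of \<open>\<Prod> m (y j) / (y j)!\<close> over the compositions \<open>y\<close> of \<open>n\<close> with counts in \<open>C\<close>. Up to the factor
  \<open>x\<^sup>n / Z\<^sup>k\<close>, which is the same for all \<open>y\<close> with sum \<open>n\<close>, the summand is the probability that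
  \<open>Y j = y j\<close> for all \<open>j\<close>, where \<open>Z\<close> is the normalising constant; the factor cancels in the conditional law.
  Both parts of the theorem are instances: values of \<open>Y j\<close> above \<open>n\<close> never contribute.
\<close>

subsection \<open>Ordered set partitions\<close>

text \<open>Empty blocks are allowed so that the multinomial count can be proved by induction for
  arbitrary sizes, zero included. A general index set \<open>J\<close> lets that induction remove
  one index, and extensionality off \<open>J\<close> keeps the set of families finite.\<close>

definition weak_ordered_partitions :: "'b set \<Rightarrow> 'a set \<Rightarrow> ('b \<Rightarrow> 'a set) set" where
  "weak_ordered_partitions J V =
     {g \<in> J \<rightarrow>\<^sub>E Pow V. disjoint_family_on g J \<and> \<Union>(g ` J) = V}"

lemma weak_ordered_partitionsI:
  assumes "\<And>j. j \<in> J \<Longrightarrow> g j \<subseteq> V" "\<And>j. j \<notin> J \<Longrightarrow> g j = undefined"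
    and "\<And>i j. i \<in> J \<Longrightarrow> j \<in> J \<Longrightarrow> i \<noteq> j \<Longrightarrow> g i \<inter> g j = {}"
    and "\<Union>(g ` J) = V"
  shows "g \<in> weak_ordered_partitions J V"
  using assms by (simp add: weak_ordered_partitions_def PiE_def Pi_def extensional_def
      disjoint_family_on_def)

lemma weak_ordered_partitionsD:
  assumes "g \<in> weak_ordered_partitions J V"
  shows "j \<in> J \<Longrightarrow> g j \<subseteq> V" "j \<notin> J \<Longrightarrow> g j = undefined"
    and "i \<in> J \<Longrightarrow> j \<in> J \<Longrightarrow> i \<noteq> j \<Longrightarrow> g i \<inter> g j = {}"
    and "\<Union>(g ` J) = V"
  using assms by (auto simp: weak_ordered_partitions_def PiE_def Pi_def extensional_def
      disjoint_family_on_def)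

definition ordered_partitions :: "'b set \<Rightarrow> 'a set \<Rightarrow> ('b \<Rightarrow> 'a set) set" where
  "ordered_partitions J V = {g \<in> weak_ordered_partitions J V. \<forall>j\<in>J. g j \<noteq> {}}"

lemma finite_ordered_partitions:
  assumes "finite J" "finite V"
  shows "finite (weak_ordered_partitions J V)" "finite (ordered_partitions J V)"
proof -
  have "finite (J \<rightarrow>\<^sub>E Pow V)"
    using assms by (intro finite_PiE) auto
  then show "finite (weak_ordered_partitions J V)"
    by (rule rev_finite_subset) (auto simp: weak_ordered_partitions_def)
  then show "finite (ordered_partitions J V)"
    by (rule rev_finite_subset) (auto simp: ordered_partitions_def)
qed

lemma ordered_partitions_alt:
  "ordered_partitions J V = {g \<in> J \<rightarrow>\<^sub>E Pow V. inj_on g J \<and> partition_on V (g ` J)}"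
proof (intro set_eqI iffI)
  fix g assume g: "g \<in> ordered_partitions J V"
  then have d: "disjoint_family_on g J" and ne: "\<forall>j\<in>J. g j \<noteq> {}"
    by (auto simp: ordered_partitions_def weak_ordered_partitions_def)
  have "inj_on g J"
    using d ne by (fastforce simp: inj_on_def disjoint_family_on_def)
  moreover have "partition_on V (g ` J)"
    using g disjoint_family_on_disjoint_image[OF d]
    by (auto simp: partition_on_def ordered_partitions_def weak_ordered_partitions_def)
  ultimately show "g \<in> {g \<in> J \<rightarrow>\<^sub>E Pow V. inj_on g J \<and> partition_on V (g ` J)}"
    using g by (auto simp: ordered_partitions_def weak_ordered_partitions_def)
next
  fix g assume "g \<in> {g \<in> J \<rightarrow>\<^sub>E Pow V. inj_on g J \<and> partition_on V (g ` J)}"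
  then have g: "g \<in> J \<rightarrow>\<^sub>E Pow V" "inj_on g J" "partition_on V (g ` J)"
    by auto
  have "disjoint_family_on g J"
    unfolding disjoint_family_on_def
    using g(2) partition_onD2[OF g(3)] by (metis disjointD image_eqI inj_on_eq_iff)
  then show "g \<in> ordered_partitions J V"
    using g by (auto simp: ordered_partitions_def weak_ordered_partitions_def partition_on_def)
qed

text \<open>Between finite sets of equal size, surjective and injective maps coincide, and the
  falling factorial counting injections is then a full factorial. This counts the numberings of the
  blocks of a partition.\<close>

lemma card_bij_PiE:
  assumes "finite J" "finite P" "card J = card P"
  shows "card {g \<in> J \<rightarrow>\<^sub>E P. g ` J = P} = fact (card J)"
proof -
  have "g ` J = P \<longleftrightarrow> inj_on g J" if "g \<in> J \<rightarrow>\<^sub>E P" for g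
  proof
    assume "g ` J = P"
    then show "inj_on g J"
      using assms by (intro eq_card_imp_inj_on) auto
  next
    assume "inj_on g J"
    then have "card (g ` J) = card P"
      using assms card_image by metis
    moreover have "g ` J \<subseteq> P"
      using that by auto
    ultimately show "g ` J = P"
      using assms card_subset_eq by metis
  qed
  then have "{g \<in> J \<rightarrow>\<^sub>E P. g ` J = P} = {g \<in> J \<rightarrow>\<^sub>E P. inj_on g J}"
    by blast
  then show ?thesis
    using card_inj_on_subset_funcset[of J P J] assms by (simp add: fact_prod_rev)
qed

text \<open>Multinomial coefficient by induction on \<open>J\<close>: choose the block of the new
  index, then distribute the remaining elements. The product form avoids division of natural
  numbers.\<close>

lemma multinomial_weak_ordered_partitions:
  assumes "finite J" "finite V" "(\<Sum>j\<in>J. y j) = card V"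
  shows "card {g \<in> weak_ordered_partitions J V. \<forall>j\<in>J. card (g j) = y j} * (\<Prod>j\<in>J. fact (y j))
    = (fact (card V) :: nat)"
  using assms
proof (induction J arbitrary: V rule: finite_induct)
  case empty
  then have "{g \<in> weak_ordered_partitions {} V. \<forall>j\<in>{}. card (g j) = y j} = {\<lambda>_. undefined}"
    by (auto simp: weak_ordered_partitions_def disjoint_family_on_def)
  then show ?case
    using empty by simp
next
  case (insert a J)
  let ?W = "\<lambda>J V. {g \<in> weak_ordered_partitions J V. \<forall>j\<in>J. card (g j) = y j}"
  \<comment> \<open>A pair consists of the block \<open>B\<close> at \<open>a\<close> and a family
    on \<open>J\<close> covering the rest of \<open>V\<close>. Restricting to \<open>J\<close> and
    updating at \<open>a\<close> are mutually inverse.\<close>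
  let ?S = "SIGMA B : {B. B \<subseteq> V \<and> card B = y a}. ?W J (V - B)"
  have "bij_betw (\<lambda>g. (g a, restrict g J)) (?W (insert a J) V) ?S"
  proof (rule bij_betw_byWitness[where f' = "\<lambda>(B, g). g(a := B)"])
    show "\<forall>g\<in>?W (insert a J) V. (\<lambda>(B, g). g(a := B)) (g a, restrict g J) = g"
    proof
      fix g assume "g \<in> ?W (insert a J) V"
      then have "g \<in> weak_ordered_partitions (insert a J) V"
        by simp
      note g = weak_ordered_partitionsD(2)[OF this]
      show "(\<lambda>(B, g). g(a := B)) (g a, restrict g J) = g"
        using g by (simp add: fun_eq_iff)
    qed
    show "\<forall>p\<in>?S. (\<lambda>g. (g a, restrict g J)) ((\<lambda>(B, g). g(a := B)) p) = p"
    proof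
      fix p assume "p \<in> ?S"
      moreover obtain B g where p: "p = (B, g)"
        by (cases p)
      ultimately have "g \<in> weak_ordered_partitions J (V - B)"
        by simp
      note g = weak_ordered_partitionsD(2)[OF this]
      show "(\<lambda>g. (g a, restrict g J)) ((\<lambda>(B, g). g(a := B)) p) = p"
        using g insert.hyps by (auto simp: p fun_eq_iff)
    qed
    show "(\<lambda>g. (g a, restrict g J)) ` ?W (insert a J) V \<subseteq> ?S"
    proof (rule image_subsetI)
      fix g assume "g \<in> ?W (insert a J) V"
      then have g: "g \<in> weak_ordered_partitions (insert a J) V"
        and y: "\<forall>j\<in>insert a J. card (g j) = y j"
        by auto
      note g' = weak_ordered_partitionsD[OF g]
      have da: "g j \<inter> g a = {}" if "j \<in> J" for j
        using g'(3)[of j a] that insert.hyps by blast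
      have un: "\<Union>(restrict g J ` J) = \<Union>(g ` J)"
        by simp
      have "restrict g J \<in> weak_ordered_partitions J (V - g a)"
      proof (rule weak_ordered_partitionsI)
        show "\<Union>(restrict g J ` J) = V - g a"
          unfolding un using g'(4) da by blast
      qed (use g'(1,3) da in \<open>simp_all, blast\<close>)
      then show "(g a, restrict g J) \<in> ?S"
        using g'(1)[of a] y by simp
    qed
    show "(\<lambda>(B, g). g(a := B)) ` ?S \<subseteq> ?W (insert a J) V"
    proof (rule image_subsetI)
      fix p assume "p \<in> ?S"
      moreover obtain B g where p: "p = (B, g)"
        by (cases p)
      ultimately have B: "B \<subseteq> V" "card B = y a"
        and g: "g \<in> weak_ordered_partitions J (V - B)" and y: "\<forall>j\<in>J. card (g j) = y j"
        by simp_all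
      note g' = weak_ordered_partitionsD[OF g]
      have upd: "(g(a := B)) j = g j" if "j \<in> J" for j
        using that insert.hyps by auto
      have "g(a := B) \<in> weak_ordered_partitions (insert a J) V"
      proof (rule weak_ordered_partitionsI)
        show "(g(a := B)) j \<subseteq> V" if "j \<in> insert a J" for j
          using g'(1)[of j] B that by auto
        show "(g(a := B)) j = undefined" if "j \<notin> insert a J" for j
          using g'(2)[of j] that by simp
        show "(g(a := B)) i \<inter> (g(a := B)) j = {}"
          if "i \<in> insert a J" "j \<in> insert a J" "i \<noteq> j" for i j
          using g'(1)[of i] g'(1)[of j] g'(3)[of i j] that by auto
        have "(g(a := B)) ` insert a J = insert B (g ` J)"
          by (simp only: fun_upd_image insertI1 if_True Diff_insert_absorb[OF insert.hyps(2)])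
        then have "\<Union>((g(a := B)) ` insert a J) = B \<union> \<Union>(g ` J)"
          by (simp only: Union_insert)
        then show "\<Union>((g(a := B)) ` insert a J) = V"
          unfolding g'(4) using B(1) by (simp only: Un_Diff_cancel Un_absorb1)
      qed
      then show "(\<lambda>(B, g). g(a := B)) p \<in> ?W (insert a J) V"
        using p B y upd by simp
    qed
  qed
  then have "card (?W (insert a J) V) = card ?S"
    by (rule bij_betw_same_card)
  also have "\<dots> = (\<Sum>B\<in>{B. B \<subseteq> V \<and> card B = y a}. card (?W J (V - B)))"
    using insert.prems insert.hyps
    by (intro card_SigmaI) (simp_all add: finite_ordered_partitions)
  finally have card: "card (?W (insert a J) V) = \<dots>" .
  \<comment> \<open>Removing \<open>B\<close> leaves exactly as many elements as the other sizes sum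
    to, so the induction hypothesis applies with the same value for every \<open>B\<close>.\<close>
  have step: "card (?W J (V - B)) * (\<Prod>j\<in>J. fact (y j)) = fact (card V - y a)"
    if "B \<subseteq> V" "card B = y a" for B
  proof -
    have "finite B" using that insert.prems finite_subset by auto
    then have "card (V - B) = card V - y a"
      using that by (simp add: card_Diff_subset)
    moreover from this have "(\<Sum>j\<in>J. y j) = card (V - B)"
      using insert.prems(2) insert.hyps by simp
    ultimately show ?thesis
      using insert.IH[of "V - B"] insert.prems(1) by simp
  qed
  have "card (?W (insert a J) V) * (\<Prod>j\<in>insert a J. fact (y j))
      = fact (y a) * (\<Sum>B\<in>{B. B \<subseteq> V \<and> card B = y a}. card (?W J (V - B)) * (\<Prod>j\<in>J. fact (y j)))"
    unfolding card prod.insert[OF insert.hyps] sum_distrib_right[symmetric]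
    by (simp only: mult_ac)
  also have "\<dots> = fact (y a) * (\<Sum>B\<in>{B. B \<subseteq> V \<and> card B = y a}. fact (card V - y a))"
    using step by simp
  also have "\<dots> = fact (y a) * fact (card V - y a) * (card V choose y a)"
    using insert.prems n_subsets[of V "y a"] by simp
  also have "\<dots> = fact (card V)"
    using insert.prems insert.hyps by (intro binomial_fact_lemma) simp
  finally show ?case .
qed

subsection \<open>Counting assemblies by their component counts\<close>

lemma card_filter_image:
  assumes "inj_on g J"
  shows "card {b \<in> g ` J. Q b} = card {j \<in> J. Q (g j)}"
proof -
  have "{b \<in> g ` J. Q b} = g ` {j \<in> J. Q (g j)}"
    by blast
  moreover have "inj_on g {j \<in> J. Q (g j)}"
    using assms by (rule inj_on_subset) blast
  ultimately show ?thesis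
    by (simp add: card_image)
qed

text \<open>Double counting: each partition \<open>P\<close> into \<open>k\<close> blocks is the
  image of \<open>k!\<close> injective families, and its number of decorations is a product over its
  blocks, the same for all of these families.\<close>

lemma fact_times_card_assemblies:
  fixes C :: "(nat \<Rightarrow> nat) set"
  assumes J: "finite J" "card J = k"
  shows "fact k * card {a \<in> assemblies_with m n k. component_count a \<in> C} =
    (\<Sum>g\<in>{g \<in> ordered_partitions J {1..n}. (\<lambda>i. card {j \<in> J. card (g j) = i}) \<in> C}.
       \<Prod>j\<in>J. m (card (g j)))"
proof -
  let ?V = "{1..n}"
  let ?c = "\<lambda>P i. card {B \<in> P. card B = (i::nat)}"
  let ?T = "{P. partition_on ?V P \<and> card P = k \<and> ?c P \<in> C}"
  let ?O = "{g \<in> ordered_partitions J ?V. (\<lambda>i. card {j \<in> J. card (g j) = i}) \<in> C}"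
  have finT: "finite ?T"
    by (rule finite_subset[of _ "Pow (Pow ?V)"]) (auto simp: partition_on_def)
  have finP: "finite P" if "P \<in> ?T" for P
    using that finite_elements[of ?V P] by auto
  have cP: "component_count (P, d) = ?c P" for P d
    by (simp add: component_count_def fun_eq_iff)
  \<comment> \<open>Both conditions on an assembly concern its partition alone, so the decorations
    still range over a full product set.\<close>
  have "{a \<in> assemblies_with m n k. component_count a \<in> C} =
      (SIGMA P : ?T. \<Pi>\<^sub>E B\<in>P. {..<m (card B)})"
  proof (rule set_eqI)
    fix a :: "nat set set \<times> (nat set \<Rightarrow> nat)"
    obtain P d where a: "a = (P, d)"
      by (cases a)
    show "a \<in> {a \<in> assemblies_with m n k. component_count a \<in> C} \<longleftrightarrow>
        a \<in> (SIGMA P : ?T. \<Pi>\<^sub>E B\<in>P. {..<m (card B)})"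
      unfolding a mem_Collect_eq cP assemblies_with_def assemblies_def mem_Sigma_iff fst_conv
      by blast
  qed
  then have "card {a \<in> assemblies_with m n k. component_count a \<in> C} =
      card (SIGMA P : ?T. \<Pi>\<^sub>E B\<in>P. {..<m (card B)})"
    by (rule arg_cong)
  also have "\<dots> = (\<Sum>P\<in>?T. card (\<Pi>\<^sub>E B\<in>P. {..<m (card B)}))"
    by (intro card_SigmaI finT ballI finite_PiE finP) simp_all
  also have "\<dots> = (\<Sum>P\<in>?T. \<Prod>B\<in>P. m (card B))"
  proof (rule sum.cong[OF refl])
    fix P assume "P \<in> ?T"
    show "card (\<Pi>\<^sub>E B\<in>P. {..<m (card B)}) = (\<Prod>B\<in>P. m (card B))"
      unfolding card_PiE[OF finP[OF \<open>P \<in> ?T\<close>]] by simp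
  qed
  finally have "fact k * card {a \<in> assemblies_with m n k. component_count a \<in> C} =
      (\<Sum>P\<in>?T. fact k * (\<Prod>B\<in>P. m (card B)))"
    by (simp add: sum_distrib_left)
  \<comment> \<open>The factor \<open>k!\<close> becomes a sum over the numberings \<open>g\<close>
    of \<open>P\<close>, each with the same summand.\<close>
  also have "\<dots> = (\<Sum>P\<in>?T. \<Sum>g\<in>{g. g \<in> ?O \<and> g ` J = P}. \<Prod>j\<in>J. m (card (g j)))"
  proof (rule sum.cong[OF refl])
    fix P assume P: "P \<in> ?T"
    have inj: "inj_on g J" if "g ` J = P" for g
      using that P J by (intro eq_card_imp_inj_on) auto
    have count: "(\<lambda>i. card {j \<in> J. card (g j) = i}) = ?c P" if "g ` J = P" for g
      by (simp only: card_filter_image[OF inj[OF that], unfolded that])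
    have "P \<subseteq> Pow ?V"
      using P by (auto simp: partition_on_def)
    then have sub: "g \<in> J \<rightarrow>\<^sub>E Pow ?V" if "g \<in> J \<rightarrow>\<^sub>E P" for g
      using that by fastforce
    have eq: "{g. g \<in> ?O \<and> g ` J = P} = {g \<in> J \<rightarrow>\<^sub>E P. g ` J = P}"
    proof (intro set_eqI iffI)
      fix g assume "g \<in> {g. g \<in> ?O \<and> g ` J = P}"
      then have "g \<in> J \<rightarrow>\<^sub>E Pow ?V" and img: "g ` J = P"
        by (simp_all add: ordered_partitions_alt)
      then have "g \<in> J \<rightarrow>\<^sub>E P"
        by (simp add: PiE_def Pi_def flip: img)
      then show "g \<in> {g \<in> J \<rightarrow>\<^sub>E P. g ` J = P}"
        using img by simp
    next
      fix g assume "g \<in> {g \<in> J \<rightarrow>\<^sub>E P. g ` J = P}"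
      then have g: "g \<in> J \<rightarrow>\<^sub>E Pow ?V" and img: "g ` J = P"
        using sub by simp_all
      have "partition_on ?V P" "?c P \<in> C"
        using P by simp_all
      then show "g \<in> {g. g \<in> ?O \<and> g ` J = P}"
        using g img inj[OF img] unfolding count[OF img, symmetric]
        by (simp add: ordered_partitions_alt)
    qed
    have "(\<Prod>j\<in>J. m (card (g j))) = (\<Prod>B\<in>P. m (card B))" if "g ` J = P" for g
      using prod.reindex[OF inj[OF that], of "\<lambda>B. m (card B)"] unfolding that o_def ..
    then have "(\<Sum>g\<in>{g \<in> J \<rightarrow>\<^sub>E P. g ` J = P}. \<Prod>j\<in>J. m (card (g j))) =
        (\<Sum>g\<in>{g \<in> J \<rightarrow>\<^sub>E P. g ` J = P}. \<Prod>B\<in>P. m (card B))"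
      by (intro sum.cong refl) blast
    then have "(\<Sum>g\<in>{g. g \<in> ?O \<and> g ` J = P}. \<Prod>j\<in>J. m (card (g j))) =
        card {g \<in> J \<rightarrow>\<^sub>E P. g ` J = P} * (\<Prod>B\<in>P. m (card B))"
      unfolding eq sum_constant of_nat_id .
    also have "card {g \<in> J \<rightarrow>\<^sub>E P. g ` J = P} = fact k"
      using card_bij_PiE[OF J(1) finP[OF P]] J P by simp
    finally show "fact k * (\<Prod>B\<in>P. m (card B)) =
        (\<Sum>g\<in>{g. g \<in> ?O \<and> g ` J = P}. \<Prod>j\<in>J. m (card (g j)))" ..
  qed
  also have "\<dots> = (\<Sum>g\<in>?O. \<Prod>j\<in>J. m (card (g j)))"
  proof (rule sum.group[OF _ finT])
    show "finite ?O"
      using J finite_ordered_partitions(2)[of J ?V] by auto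
    show "(\<lambda>g. g ` J) ` ?O \<subseteq> ?T"
    proof (rule image_subsetI)
      fix g assume "g \<in> ?O"
      then have g: "g \<in> ordered_partitions J ?V"
        and C: "(\<lambda>i. card {j \<in> J. card (g j) = i}) \<in> C"
        by auto
      have inj: "inj_on g J" and part: "partition_on ?V (g ` J)"
        using g by (auto simp: ordered_partitions_alt)
      have "?c (g ` J) = (\<lambda>i. card {j \<in> J. card (g j) = i})"
        unfolding card_filter_image[OF inj] ..
      then show "g ` J \<in> ?T"
        using C part card_image[OF inj] J by simp
    qed
  qed
  finally show ?thesis .
qed

section \<open>From ordered partitions to compositions of \<open>n\<close>\<close>

definition compositions :: "'b set \<Rightarrow> nat \<Rightarrow> ('b \<Rightarrow> nat) set" where
  "compositions J n = {y \<in> J \<rightarrow>\<^sub>E {1..n}. sum y J = n}"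

lemma finite_compositions: "finite J \<Longrightarrow> finite (compositions J n)"
  using finite_PiE[of J "\<lambda>_. {1..n}"]
  by (rule finite_subset[rotated]) (auto simp: compositions_def)

text \<open>Ordered partitions are grouped by their vector \<open>y\<close> of block sizes. The
  summand is constant on a fibre, and the multinomial count gives the size of the fibre as
  \<open>n!\<close> divided by the product of the \<open>fact (y j)\<close>.\<close>

lemma card_assemblies_compositions:
  fixes C :: "(nat \<Rightarrow> nat) set"
  assumes J: "finite J" "card J = k"
  shows "fact k * real (card {a \<in> assemblies_with m n k. component_count a \<in> C}) =
    fact n * (\<Sum>y\<in>{y \<in> compositions J n. (\<lambda>i. card {j \<in> J. y j = i}) \<in> C}.
       \<Prod>j\<in>J. real (m (y j)) / fact (y j))"
proof -
  let ?V = "{1..n}"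
  let ?O = "{g \<in> ordered_partitions J ?V. (\<lambda>i. card {j \<in> J. card (g j) = i}) \<in> C}"
  let ?Y = "{y \<in> compositions J n. (\<lambda>i. card {j \<in> J. y j = i}) \<in> C}"
  let ?s = "\<lambda>g. restrict (\<lambda>j. card (g j)) J"
  have r: "(\<lambda>i. card {j \<in> J. restrict z J j = i}) = (\<lambda>i. card {j \<in> J. z j = i})"
    for z :: "_ \<Rightarrow> nat"
    by (auto simp: fun_eq_iff intro!: arg_cong[where f = card])
  \<comment> \<open>The blocks are disjoint and cover \<open>?V\<close>, so their sizes sum to
    \<open>n\<close>; nonemptiness makes each size at least 1.\<close>
  have size: "?s g \<in> compositions J n" if "g \<in> ordered_partitions J ?V" for g
  proof -
    have g: "g j \<subseteq> ?V" "g j \<noteq> {}" if "j \<in> J" for j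
      using \<open>g \<in> _\<close> that by (auto simp: ordered_partitions_def weak_ordered_partitions_def)
    have "card (\<Union>(g ` J)) = (\<Sum>j\<in>J. card (g j))"
      using that g J finite_subset[of _ ?V]
      by (intro card_UN_disjoint)
         (auto simp: ordered_partitions_def weak_ordered_partitions_def disjoint_family_on_def)
    moreover have "\<Union>(g ` J) = ?V"
      using that by (auto simp: ordered_partitions_def weak_ordered_partitions_def)
    moreover have "card (g j) \<in> {1..n}" if "j \<in> J" for j
      using g[OF that] card_mono[of ?V "g j"] finite_subset[of "g j" ?V]
      by (simp add: Suc_le_eq card_gt_0_iff)
    ultimately show ?thesis
      by (simp add: compositions_def)
  qed
  have finY: "finite ?Y"
    using finite_compositions[of J n] J by auto
  have "fact k * card {a \<in> assemblies_with m n k. component_count a \<in> C} =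
      (\<Sum>g\<in>?O. \<Prod>j\<in>J. m (card (g j)))"
    by (rule fact_times_card_assemblies[OF J])
  also have "\<dots> = (\<Sum>y\<in>?Y. \<Sum>g\<in>{g. g \<in> ?O \<and> ?s g = y}. \<Prod>j\<in>J. m (card (g j)))"
  proof (rule sum.group[symmetric, OF _ finY])
    show "finite ?O"
      using J finite_ordered_partitions(2)[of J ?V] by auto
    show "?s ` ?O \<subseteq> ?Y"
    proof (rule image_subsetI)
      fix g assume "g \<in> ?O"
      then show "?s g \<in> ?Y"
        using size[of g] r[of "\<lambda>j. card (g j)"] by simp
    qed
  qed
  finally have "real (fact k * card {a \<in> assemblies_with m n k. component_count a \<in> C}) =
      real (\<Sum>y\<in>?Y. \<Sum>g\<in>{g. g \<in> ?O \<and> ?s g = y}. \<Prod>j\<in>J. m (card (g j)))"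
    by (rule arg_cong)
  then have "fact k * real (card {a \<in> assemblies_with m n k. component_count a \<in> C}) =
      (\<Sum>y\<in>?Y. real (\<Sum>g\<in>{g. g \<in> ?O \<and> ?s g = y}. \<Prod>j\<in>J. m (card (g j))))"
    by (simp only: of_nat_mult of_nat_fact of_nat_sum)
  also have "\<dots> = (\<Sum>y\<in>?Y. fact n * (\<Prod>j\<in>J. real (m (y j)) / fact (y j)))"
  proof (rule sum.cong[OF refl])
    fix y assume y: "y \<in> ?Y"
    let ?W = "{g \<in> weak_ordered_partitions J ?V. \<forall>j\<in>J. card (g j) = y j}"
    have pos: "y j \<ge> 1" if "j \<in> J" for j
      using y that by (auto simp: compositions_def)
    have ext: "y j = undefined" if "j \<notin> J" for j
      using y that by (auto simp: compositions_def)
    \<comment> \<open>Since all \<open>y j\<close> are positive, prescribing the sizes already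
      forces nonempty blocks. The fibre over \<open>y\<close> is therefore the set counted by the
      multinomial lemma for weak partitions.\<close>
    have eq: "{g. g \<in> ?O \<and> ?s g = y} = ?W"
    proof (intro set_eqI iffI)
      fix g assume "g \<in> {g. g \<in> ?O \<and> ?s g = y}"
      then have g: "g \<in> ordered_partitions J ?V" and s: "?s g = y"
        by auto
      have "card (g j) = y j" if "j \<in> J" for j
        using fun_cong[OF s, of j] that by simp
      then show "g \<in> ?W"
        using g by (simp add: ordered_partitions_def)
    next
      fix g assume g: "g \<in> ?W"
      then have s: "?s g = y" using ext by (simp add: fun_eq_iff)
      have "g j \<noteq> {}" if "j \<in> J" for j
      proof
        assume "g j = {}"
        then show False using pos[OF that] g that by force
      qed
      then have "g \<in> ordered_partitions J ?V"
        using g by (simp add: ordered_partitions_def)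
      moreover have "(\<lambda>i. card {j \<in> J. card (g j) = i}) \<in> C"
        using y s unfolding r[of "\<lambda>j. card (g j)", symmetric] by simp
      ultimately show "g \<in> {g. g \<in> ?O \<and> ?s g = y}"
        using s by simp
    qed
    have "(\<Sum>g\<in>{g. g \<in> ?O \<and> ?s g = y}. \<Prod>j\<in>J. m (card (g j))) = (\<Sum>g\<in>?W. \<Prod>j\<in>J. m (y j))"
      unfolding eq by (intro sum.cong prod.cong refl) simp
    then have sum: "real (\<Sum>g\<in>{g. g \<in> ?O \<and> ?s g = y}. \<Prod>j\<in>J. m (card (g j))) =
        real (card ?W) * (\<Prod>j\<in>J. real (m (y j)))"
      by (simp only: sum_constant of_nat_mult of_nat_prod of_nat_id)
    have "real (card ?W * (\<Prod>j\<in>J. fact (y j))) = real (fact n)"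
      using multinomial_weak_ordered_partitions[of J ?V y] J y by (simp add: compositions_def)
    then have card: "real (card ?W) * (\<Prod>j\<in>J. fact (y j)) = fact n"
      by (simp only: of_nat_mult of_nat_fact of_nat_prod)
    have nz: "(\<Prod>j\<in>J. fact (y j)) \<noteq> (0 :: real)"
      using J by simp
    have "real (card ?W) = fact n / (\<Prod>j\<in>J. fact (y j))"
      using card unfolding nonzero_eq_divide_eq[OF nz] .
    then show "real (\<Sum>g\<in>{g. g \<in> ?O \<and> ?s g = y}. \<Prod>j\<in>J. m (card (g j))) =
        fact n * (\<Prod>j\<in>J. real (m (y j)) / fact (y j))"
      unfolding sum by (simp only: prod_dividef times_divide_eq_left times_divide_eq_right)
  qed
  finally show ?thesis
    by (simp add: sum_distrib_left)
qed

lemma finite_assemblies_with: "finite (assemblies_with m n k)"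
proof -
  have "finite {P. partition_on {1..n} P}"
    by (rule finite_subset[of _ "Pow (Pow {1..n})"]) (auto simp: partition_on_def)
  moreover have "finite (\<Pi>\<^sub>E B\<in>P. {..<m (card B)})" if "partition_on {1..n} P" for P
    using finite_elements[OF _ that] by (intro finite_PiE) auto
  ultimately have "finite (assemblies m n)"
    unfolding assemblies_def by (intro finite_SigmaI) auto
  then show ?thesis
    by (simp add: assemblies_with_def)
qed

subsection \<open>Conditioned samples of component sizes\<close>

lemma weight_nonneg: "x \<ge> 0 \<Longrightarrow> weight m x i \<ge> 0"
  by (simp add: weight_def)

text \<open>Some assembly exists and has at least one block \<open>B\<close>; a decoration of
  \<open>B\<close> witnesses \<open>m (card B) > 0\<close>. This makes both normalising constants
  positive.\<close>

lemma ex_weight_pos: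
  assumes "1 \<le> k" "num_assemblies m n k > 0" "x > 0"
  shows "\<exists>i\<in>{1..n}. weight m x i > 0"
proof -
  obtain P d where a: "(P, d) \<in> assemblies_with m n k"
    using assms(2) by (auto simp: num_assemblies_def card_gt_0_iff)
  then have part: "partition_on {1..n} P" and d: "d \<in> (\<Pi>\<^sub>E B\<in>P. {..<m (card B)})"
    and "card P = k"
    by (simp_all add: assemblies_with_def assemblies_def)
  then have "P \<noteq> {}"
    using assms(1) by auto
  then obtain B where B: "B \<in> P"
    by blast
  then have sub: "B \<subseteq> {1..n}" and "B \<noteq> {}"
    using part by (auto simp: partition_on_def)
  then have "card B \<noteq> 0"
    using finite_subset[OF sub] by simp
  moreover have "card B \<le> n"
    using card_mono[OF _ sub] by simp
  moreover have "m (card B) > 0"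
    using PiE_mem[OF d B] by auto
  then have "weight m x (card B) > 0"
    using assms(3) by (simp add: weight_def)
  ultimately show ?thesis
    by (intro bexI[of _ "card B"]) auto
qed

text \<open>The mass at \<open>i\<close> and the mass on any finite part of \<open>S\<close> add up
  to at most 1. As the finite parts exhaust total mass 1, nothing remains for \<open>i\<close>. This
  is needed because \<open>iid_with\<close> prescribes probabilities only on
  \<open>S\<close>.\<close>

lemma (in prob_space) prob_eq_zero_outside_support:
  fixes X :: "'a \<Rightarrow> nat"
  assumes X: "X \<in> measurable M (count_space UNIV)"
    and q: "\<And>i. i \<in> S \<Longrightarrow> prob {\<omega> \<in> space M. X \<omega> = i} = q i"
    and sum: "(q has_sum 1) S" and i: "i \<notin> S"
  shows "prob {\<omega> \<in> space M. X \<omega> = i} = 0"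
proof -
  let ?E = "\<lambda>i. {\<omega> \<in> space M. X \<omega> = i}"
  have ev: "?E i \<in> events" for i
    using X by measurable
  have "sum q F \<le> 1 - prob (?E i)" if F: "finite F" "F \<subseteq> S" for F
  proof -
    have "prob (?E i) + sum q F = (\<Sum>l\<in>insert i F. prob (?E l))"
      using F i q by (subst sum.insert) (auto intro!: sum.cong)
    also have "\<dots> = prob (\<Union>l\<in>insert i F. ?E l)"
      using F ev by (intro finite_measure_finite_Union[symmetric])
        (auto simp: disjoint_family_on_def)
    also have "\<dots> \<le> 1"
      by (rule prob_le_1)
    finally show ?thesis
      by simp
  qed
  from has_sum_le_finite_sums[OF sum this] have "prob (?E i) \<le> 0"
    by simp
  then show ?thesis
    using measure_nonneg[of M "?E i"] by linarith
qed

lemma (in prob_space) prob_indep_vars_point: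
  assumes "indep_vars (\<lambda>_. count_space UNIV) Y J" "finite J" "J \<noteq> {}"
  shows "prob {\<omega> \<in> space M. \<forall>j\<in>J. Y j \<omega> = y j} =
    (\<Prod>j\<in>J. prob {\<omega> \<in> space M. Y j \<omega> = y j})"
proof -
  have "{\<omega> \<in> space M. \<forall>j\<in>J. Y j \<omega> = y j} = (\<Inter>j\<in>J. Y j -` {y j} \<inter> space M)"
    using assms(3) by auto
  moreover have "{\<omega> \<in> space M. Y j \<omega> = y j} = Y j -` {y j} \<inter> space M" for j
    by auto
  ultimately show ?thesis
    using indep_varsD_finite[OF assms(1,3,2), of "\<lambda>j. {y j}"] by simp
qed

text \<open>Common setting of both parts, with \<open>S\<close> equal to \<open>{1..n}\<close> or
  \<open>{1..}\<close>. The bounds on \<open>S\<close> say that every part of a composition of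
  \<open>n\<close> is an admissible value and that 0 is not.\<close>

locale sampled_components = prob_space \<Omega> for \<Omega> :: "'w measure" +
  fixes m :: "nat \<Rightarrow> nat" and n k :: nat and x Z :: real and S :: "nat set"
    and Y :: "nat \<Rightarrow> 'w \<Rightarrow> nat"
  assumes k: "1 \<le> k" and x: "x > 0" and Z: "Z > 0"
    and S: "{1..n} \<subseteq> S" "S \<subseteq> {1..}"
    and sum_weight: "(weight m x has_sum Z) S"
    and indep: "indep_vars (\<lambda>_. count_space UNIV) Y {1..k}"
    and prob_Y: "\<And>j i. j \<in> {1..k} \<Longrightarrow> i \<in> S \<Longrightarrow>
      prob {\<omega> \<in> space \<Omega>. Y j \<omega> = i} = weight m x i / Z"
begin

lemma Y_measurable: "j \<in> {1..k} \<Longrightarrow> Y j \<in> measurable \<Omega> (count_space UNIV)"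
  using indep by (simp add: indep_vars_def)

lemma prob_Y_outside:
  assumes "j \<in> {1..k}" "i \<notin> S"
  shows "prob {\<omega> \<in> space \<Omega>. Y j \<omega> = i} = 0"
proof (rule prob_eq_zero_outside_support[OF Y_measurable[OF assms(1)] _ _ assms(2)])
  have "((\<lambda>i. weight m x i * inverse Z) has_sum Z * inverse Z) S"
    by (rule has_sum_cmult_left[OF sum_weight])
  then show "((\<lambda>i. weight m x i / Z) has_sum 1) S"
    using Z by (simp add: divide_inverse)
qed (use prob_Y assms(1) in auto)

lemma events_point: "{\<omega> \<in> space \<Omega>. \<forall>j\<in>{1..k}. Y j \<omega> = y j} \<in> events"
proof -
  have "{\<omega> \<in> space \<Omega>. \<forall>j\<in>{1..k}. Y j \<omega> = y j} =
      (\<Inter>j\<in>{1..k}. Y j -` {y j} \<inter> space \<Omega>)"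
    using k by auto
  moreover have "\<dots> \<in> events"
    using k Y_measurable by (intro sets.finite_INT measurable_sets) auto
  ultimately show ?thesis
    by simp
qed

text \<open>If the sum is \<open>n\<close>, no summand exceeds \<open>n\<close>, so only finitely
  many value vectors occur. The range starts at 0 because the variables avoid 0 only almost
  surely.\<close>

lemma sum_event_decompose:
  fixes C :: "(nat \<Rightarrow> nat) set"
  defines "T \<equiv> {y \<in> {1..k} \<rightarrow>\<^sub>E {0..n}. sum y {1..k} = n \<and> (\<lambda>i. card {j \<in> {1..k}. y j = i}) \<in> C}"
  shows "{\<omega> \<in> sum_event \<Omega> Y k n. occurrences Y k \<omega> \<in> C} =
    (\<Union>y\<in>T. {\<omega> \<in> space \<Omega>. \<forall>j\<in>{1..k}. Y j \<omega> = y j})"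
proof (intro set_eqI iffI)
  fix \<omega> assume "\<omega> \<in> {\<omega> \<in> sum_event \<Omega> Y k n. occurrences Y k \<omega> \<in> C}"
  then have \<omega>: "\<omega> \<in> space \<Omega>" "(\<Sum>j\<in>{1..k}. Y j \<omega>) = n"
    and C: "(\<lambda>i. card {j \<in> {1..k}. Y j \<omega> = i}) \<in> C"
    by (simp_all add: sum_event_def occurrences_def[abs_def])
  let ?y = "restrict (\<lambda>j. Y j \<omega>) {1..k}"
  have "Y j \<omega> \<le> n" if "j \<in> {1..k}" for j
    using member_le_sum[of j "{1..k}" "\<lambda>j. Y j \<omega>"] that \<omega>(2) by simp
  then have "?y \<in> {1..k} \<rightarrow>\<^sub>E {0..n}"
    by simp
  moreover have "sum ?y {1..k} = n"
    using \<omega>(2) by simp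
  moreover have "{j \<in> {1..k}. ?y j = i} = {j \<in> {1..k}. Y j \<omega> = i}" for i
    by (rule Collect_cong) auto
  then have "(\<lambda>i. card {j \<in> {1..k}. ?y j = i}) \<in> C"
    using C by simp
  ultimately have "?y \<in> T"
    unfolding T_def by blast
  then show "\<omega> \<in> (\<Union>y\<in>T. {\<omega> \<in> space \<Omega>. \<forall>j\<in>{1..k}. Y j \<omega> = y j})"
    using \<omega>(1) by (intro UN_I[of ?y]) simp_all
next
  fix \<omega> assume "\<omega> \<in> (\<Union>y\<in>T. {\<omega> \<in> space \<Omega>. \<forall>j\<in>{1..k}. Y j \<omega> = y j})"
  then obtain y where y: "y \<in> T" and \<omega>: "\<omega> \<in> space \<Omega>" "\<forall>j\<in>{1..k}. Y j \<omega> = y j"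
    by blast
  have "(\<Sum>j\<in>{1..k}. Y j \<omega>) = sum y {1..k}"
    using \<omega>(2) by (intro sum.cong) auto
  moreover have "{j \<in> {1..k}. Y j \<omega> = i} = {j \<in> {1..k}. y j = i}" for i
    using \<omega>(2) by auto
  ultimately show "\<omega> \<in> {\<omega> \<in> sum_event \<Omega> Y k n. occurrences Y k \<omega> \<in> C}"
    using y \<omega>(1) by (simp add: T_def sum_event_def occurrences_def[abs_def])
qed

lemma finite_sum_event_index:
  "finite {y \<in> {1..k} \<rightarrow>\<^sub>E {0..n}. sum y {1..k} = n \<and> (\<lambda>i. card {j \<in> {1..k}. y j = i}) \<in> C}"
  by (rule finite_subset[of _ "{1..k} \<rightarrow>\<^sub>E {0..n}"]) (auto intro: finite_PiE)

lemma events_occurrences: "{\<omega> \<in> sum_event \<Omega> Y k n. occurrences Y k \<omega> \<in> C} \<in> events"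
  unfolding sum_event_decompose
  by (intro sets.finite_UN finite_sum_event_index events_point)

text \<open>Summing the probabilities of single value vectors yields the composition sum that counts
  assemblies. The prefactor does not involve \<open>C\<close>, so it cancels in conditional
  probabilities.\<close>

lemma prob_occurrences:
  "prob {\<omega> \<in> sum_event \<Omega> Y k n. occurrences Y k \<omega> \<in> C} =
    x ^ n * fact k / (Z ^ k * fact n) *
    real (card {a \<in> assemblies_with m n k. component_count a \<in> C})"
proof -
  let ?J = "{1..k}"
  let ?c = "\<lambda>y i. card {j \<in> ?J. y j = (i :: nat)}"
  let ?T = "{y \<in> ?J \<rightarrow>\<^sub>E {0..n}. sum y ?J = n \<and> ?c y \<in> C}"
  let ?E = "\<lambda>y. {\<omega> \<in> space \<Omega>. \<forall>j\<in>?J. Y j \<omega> = y j}"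
  let ?Q = "{y \<in> compositions ?J n. ?c y \<in> C}"
  have disj: "disjoint_family_on ?E ?T"
    unfolding disjoint_family_on_def
  proof (intro ballI impI)
    fix y z assume y: "y \<in> ?T" and z: "z \<in> ?T" and "y \<noteq> z"
    have "y \<in> ?J \<rightarrow>\<^sub>E {0..n}" "z \<in> ?J \<rightarrow>\<^sub>E {0..n}"
      using y z by simp_all
    with \<open>y \<noteq> z\<close> have "\<exists>j\<in>?J. y j \<noteq> z j"
      using PiE_ext by metis
    then show "?E y \<inter> ?E z = {}"
      by fastforce
  qed
  have prob_E: "prob (?E y) = (\<Prod>j\<in>?J. prob {\<omega> \<in> space \<Omega>. Y j \<omega> = y j})" for y
    using k by (intro prob_indep_vars_point[OF indep]) auto
  have "prob {\<omega> \<in> sum_event \<Omega> Y k n. occurrences Y k \<omega> \<in> C} = (\<Sum>y\<in>?T. prob (?E y))"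
    unfolding sum_event_decompose
    by (intro finite_measure_finite_Union finite_sum_event_index disj image_subsetI events_point)
  \<comment> \<open>Vectors that are not compositions contain a zero entry; 0 lies outside
    \<open>S\<close>, so one factor of the product vanishes.\<close>
  also have "\<dots> = (\<Sum>y\<in>?Q. prob (?E y))"
  proof (rule sum.mono_neutral_right[OF finite_sum_event_index])
    show "?Q \<subseteq> ?T"
      by (auto simp: compositions_def PiE_def Pi_def)
    show "\<forall>y\<in>?T - ?Q. prob (?E y) = 0"
    proof
      fix y assume y: "y \<in> ?T - ?Q"
      have "\<exists>j\<in>?J. y j = 0"
      proof (rule ccontr)
        assume "\<not> (\<exists>j\<in>?J. y j = 0)"
        then have "y \<in> ?J \<rightarrow>\<^sub>E {1..n}"
          using y by (simp add: PiE_def Pi_def Suc_le_eq)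
        then show False
          using y unfolding compositions_def by blast
      qed
      then obtain j where j: "j \<in> ?J" "y j \<notin> S"
        using S(2) by force
      then show "prob (?E y) = 0"
        unfolding prob_E using prob_Y_outside[OF j] by (intro prod_zero) auto
    qed
  qed
  also have "\<dots> = (\<Sum>y\<in>?Q. x ^ n / Z ^ k * (\<Prod>j\<in>?J. real (m (y j)) / fact (y j)))"
  proof (rule sum.cong[OF refl])
    fix y assume "y \<in> ?Q"
    then have y: "y \<in> ?J \<rightarrow>\<^sub>E {1..n}" "sum y ?J = n"
      by (simp_all add: compositions_def)
    have "prob (?E y) = (\<Prod>j\<in>?J. weight m x (y j) / Z)"
      unfolding prob_E
    proof (rule prod.cong[OF refl])
      fix j assume j: "j \<in> ?J"
      then have "y j \<in> S"
        using PiE_mem[OF y(1) j] S(1) by blast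
      then show "prob {\<omega> \<in> space \<Omega>. Y j \<omega> = y j} = weight m x (y j) / Z"
        by (rule prob_Y[OF j])
    qed
    also have "\<dots> = (\<Prod>j\<in>?J. x ^ y j * (real (m (y j)) / fact (y j))) / Z ^ k"
      by (simp add: prod_dividef weight_def prod.distrib mult_ac)
    \<comment> \<open>The exponents \<open>y j\<close> add up to \<open>n\<close>, so the power of
      \<open>x\<close> is the same for every composition.\<close>
    also have "\<dots> = x ^ n / Z ^ k * (\<Prod>j\<in>?J. real (m (y j)) / fact (y j))"
      using y(2) by (simp only: prod.distrib power_sum[symmetric] times_divide_eq_left)
    finally show "prob (?E y) = x ^ n / Z ^ k * (\<Prod>j\<in>?J. real (m (y j)) / fact (y j))" .
  qed
  also have "\<dots> = x ^ n / Z ^ k * (\<Sum>y\<in>?Q. \<Prod>j\<in>?J. real (m (y j)) / fact (y j))"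
    by (rule sum_distrib_left[symmetric])
  also have "(\<Sum>y\<in>?Q. \<Prod>j\<in>?J. real (m (y j)) / fact (y j)) =
      fact k * real (card {a \<in> assemblies_with m n k. component_count a \<in> C}) / fact n"
    using card_assemblies_compositions[of ?J k m n C]
    by (simp only: finite_atLeastAtMost card_atLeastAtMost nonzero_mult_div_cancel_left
        diff_Suc_1 fact_nonzero not_False_eq_True)
  finally show ?thesis
    by simp
qed

lemma sum_event_measure:
  "prob (sum_event \<Omega> Y k n) = x ^ n * fact k / (Z ^ k * fact n) * real (num_assemblies m n k)"
  using prob_occurrences[of UNIV] by (simp add: num_assemblies_def)

lemma occurrences_measurable:
  "(\<lambda>\<omega>. restrict (occurrences Y k \<omega>) I) \<in> measurable \<Omega> (count_space UNIV)"
proof -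
  \<comment> \<open>The vector lives in an uncountable type, but it factors through the countable type \<open>nat list\<close>.\<close>
  let ?t = "\<lambda>\<omega>. map (\<lambda>j. Y j \<omega>) [1..<Suc k]"
  let ?f = "\<lambda>ys. restrict (\<lambda>i. card {j \<in> {1..k}. ys ! (j - 1) = i}) I"
  have "?t \<in> measurable \<Omega> (count_space UNIV)"
  proof (subst measurable_count_space_eq_countable, rule countableI_type, intro conjI ballI)
    fix ys :: "nat list"
    show "?t -` {ys} \<inter> space \<Omega> \<in> events"
    proof (cases "length ys = k")
      case True
      \<comment> \<open>List positions start at 0 and the variables at 1, hence the index
        \<open>j - 1\<close>.\<close>
      have "?t -` {ys} \<inter> space \<Omega> = {\<omega> \<in> space \<Omega>. \<forall>j\<in>{1..k}. Y j \<omega> = ys ! (j - 1)}"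
      proof -
        have "?t \<omega> = ys \<longleftrightarrow> (\<forall>i<k. Y (Suc i) \<omega> = ys ! i)" for \<omega>
          using True by (auto simp: list_eq_iff_nth_eq simp del: upt_Suc)
        also have "\<dots> \<omega> \<longleftrightarrow> (\<forall>j\<in>{1..k}. Y j \<omega> = ys ! (j - 1))" for \<omega>
          by (auto simp: Suc_le_eq gr0_conv_Suc)
        finally show ?thesis
          by (simp add: vimage_def Int_def conj_commute del: upt_Suc)
      qed
      then show ?thesis
        using events_point by simp
    next
      case False
      then have "?t -` {ys} = {}"
        by auto
      then show ?thesis
        by simp
    qed
  qed auto
  then have "?f \<circ> ?t \<in> measurable \<Omega> (count_space UNIV)"
    by (rule measurable_comp) simp
  moreover have "?f \<circ> ?t = (\<lambda>\<omega>. restrict (occurrences Y k \<omega>) I)"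
  proof
    fix \<omega>
    have "{j \<in> {1..k}. ?t \<omega> ! (j - 1) = i} = {j \<in> {1..k}. Y j \<omega> = i}" for i
      by (rule Collect_cong) (auto simp del: upt_Suc)
    then show "(?f \<circ> ?t) \<omega> = restrict (occurrences Y k \<omega>) I"
      by (simp add: occurrences_def[abs_def] del: upt_Suc)
  qed
  ultimately show ?thesis
    by simp
qed

text \<open>Both numerator and denominator of the conditional probability are assembly counts times
  the same positive constant. The quotient is thus the proportion of assemblies with the given
  counts, which is the uniform law.\<close>

lemma conditional_law_eq:
  assumes "num_assemblies m n k > 0"
  shows "prob (sum_event \<Omega> Y k n) > 0"
    and "conditional_law \<Omega> Y k n I = measure_pmf (component_law m n k I)"
proof -
  show pos: "prob (sum_event \<Omega> Y k n) > 0"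
    using assms x Z by (simp add: sum_event_measure)
  let ?A = "assemblies_with m n k"
  let ?c = "x ^ n * fact k / (Z ^ k * fact n)"
  have ne: "?A \<noteq> {}"
    using assms by (auto simp: num_assemblies_def)
  have ev: "sum_event \<Omega> Y k n \<in> events"
    using events_occurrences[of UNIV] by simp
  show "conditional_law \<Omega> Y k n I = measure_pmf (component_law m n k I)"
  proof (rule measure_eqI)
    fix D assume "D \<in> sets (conditional_law \<Omega> Y k n I)"
    \<comment> \<open>Pulling \<open>D\<close> back along the restriction to \<open>I\<close> turns
      it into a condition on full count vectors, as \<open>prob_occurrences\<close> expects.\<close>
    let ?C = "{v. restrict v I \<in> D}"
    let ?F = "\<lambda>\<omega>. restrict (occurrences Y k \<omega>) I"
    let ?N = "card {a \<in> ?A. component_count a \<in> ?C}"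
    have meas: "?F -` D \<inter> space \<Omega> \<in> events"
      by (rule measurable_sets[OF occurrences_measurable]) simp
    have int: "sum_event \<Omega> Y k n \<inter> (?F -` D \<inter> space \<Omega>) =
        {\<omega> \<in> sum_event \<Omega> Y k n. occurrences Y k \<omega> \<in> ?C}"
      by (auto simp: sum_event_def)
    \<comment> \<open>The conditioned measure has the same space and events as
      \<open>\<Omega>\<close>, so measurability of the count vector carries over.\<close>
    have "emeasure (conditional_law \<Omega> Y k n I) D =
        emeasure (uniform_measure \<Omega> (sum_event \<Omega> Y k n)) (?F -` D \<inter> space \<Omega>)"
      unfolding conditional_law_def
      by (subst emeasure_distr) (use occurrences_measurable in \<open>simp_all add: measurable_def\<close>)
    also have "\<dots> = emeasure \<Omega> {\<omega> \<in> sum_event \<Omega> Y k n. occurrences Y k \<omega> \<in> ?C} /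
        emeasure \<Omega> (sum_event \<Omega> Y k n)"
      unfolding emeasure_uniform_measure[OF ev meas] int ..
    also have "\<dots> = ennreal (prob {\<omega> \<in> sum_event \<Omega> Y k n. occurrences Y k \<omega> \<in> ?C} /
        prob (sum_event \<Omega> Y k n))"
      unfolding emeasure_eq_measure by (rule divide_ennreal[OF measure_nonneg pos])
    also have "prob {\<omega> \<in> sum_event \<Omega> Y k n. occurrences Y k \<omega> \<in> ?C} /
        prob (sum_event \<Omega> Y k n) = real ?N / real (card ?A)"
      unfolding prob_occurrences sum_event_measure num_assemblies_def
      using x Z by (intro nonzero_mult_divide_mult_cancel_left) simp
    also have "\<dots> = measure (pmf_of_set ?A) {a. component_count a \<in> ?C}"
      unfolding measure_pmf_of_set[OF ne finite_assemblies_with] by (simp add: Int_def)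
    also have "\<dots> = measure (component_law m n k I) D"
      by (simp add: component_law_def vimage_def)
    finally show "emeasure (conditional_law \<Omega> Y k n I) D = emeasure (component_law m n k I) D"
      by (simp add: measure_pmf.emeasure_eq_measure)
  qed (simp add: conditional_law_def)
qed

end

text \<open>The two halves instantiate the locale with a finite and with an infinite support.
  Positivity of the normalising constant and of the conditioning event is part of the claim, so the
  quotients and the conditional law are meaningful.\<close>

theorem mainTheorem4:
  fixes m :: "nat \<Rightarrow> nat" and n k :: nat
  assumes "1 \<le> k" and "k \<le> n" and "num_assemblies m n k > 0"
  shows
    "(\<forall>x>0. (\<Sum>i = 1..n. weight m x i) > 0 \<and>
       (\<forall>(\<Omega> :: 'w measure) Y.
          iid_with \<Omega> Y k {1..n} (\<lambda>i. weight m x i / (\<Sum>l = 1..n. weight m x l)) \<longrightarrow>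
            measure \<Omega> (sum_event \<Omega> Y k n) > 0 \<and>
            conditional_law \<Omega> Y k n {1..n} = measure_pmf (component_law m n k {1..n})))
     \<and>
     (\<forall>x>0. weight m x summable_on {1..} \<longrightarrow> egf m x > 0 \<and>
       (\<forall>(\<Omega> :: 'w measure) Y.
          iid_with \<Omega> Y k {1..} (\<lambda>i. weight m x i / egf m x) \<longrightarrow>
            measure \<Omega> (sum_event \<Omega> Y k n) > 0 \<and>
            conditional_law \<Omega> Y k n {1..} = measure_pmf (component_law m n k {1..})))"
proof (intro conjI allI impI)
  fix x :: real assume x: "x > 0"
  obtain i where i: "i \<in> {1..n}" "weight m x i > 0"
    using ex_weight_pos[OF assms(1,3) x] by blast
  show Z: "(\<Sum>i = 1..n. weight m x i) > 0"
    using i x by (intro sum_pos2[of _ i]) (auto intro: weight_nonneg)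
  fix \<Omega> :: "'w measure" and Y
  assume iid: "iid_with \<Omega> Y k {1..n} (\<lambda>i. weight m x i / (\<Sum>l = 1..n. weight m x l))"
  interpret prob_space \<Omega>
    using iid by (simp add: iid_with_def)
  interpret sampled_components \<Omega> m n k x "\<Sum>l = 1..n. weight m x l" "{1..n}" Y
    by unfold_locales (use iid assms(1) x Z in \<open>auto simp: iid_with_def\<close>)
  show "measure \<Omega> (sum_event \<Omega> Y k n) > 0"
    by (rule conditional_law_eq(1)[OF assms(3)])
  show "conditional_law \<Omega> Y k n {1..n} = measure_pmf (component_law m n k {1..n})"
    by (rule conditional_law_eq(2)[OF assms(3)])
next
  fix x :: real assume x: "x > 0" and summable: "weight m x summable_on {1..}"
  then have sum: "(weight m x has_sum egf m x) {1..}"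
    unfolding egf_def by (intro has_sum_infsum)
  obtain i where i: "i \<in> {1..n}" "weight m x i > 0"
    using ex_weight_pos[OF assms(1,3) x] by blast
  \<comment> \<open>With nonnegative terms, the single positive weight at \<open>i\<close> bounds
    the infinite sum from below.\<close>
  have "(\<Sum>l\<in>{i}. weight m x l) \<le> egf m x"
    unfolding egf_def using i x by (intro finite_sum_le_infsum summable) (auto intro: weight_nonneg)
  then show Z: "egf m x > 0"
    using i by simp
  fix \<Omega> :: "'w measure" and Y
  assume iid: "iid_with \<Omega> Y k {1..} (\<lambda>i. weight m x i / egf m x)"
  interpret prob_space \<Omega>
    using iid by (simp add: iid_with_def)
  interpret sampled_components \<Omega> m n k x "egf m x" "{1..}" Y
    by unfold_locales (use iid assms(1) x Z sum in \<open>auto simp: iid_with_def\<close>)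
  show "measure \<Omega> (sum_event \<Omega> Y k n) > 0"
    by (rule conditional_law_eq(1)[OF assms(3)])
  show "conditional_law \<Omega> Y k n {1..} = measure_pmf (component_law m n k {1..})"
    by (rule conditional_law_eq(2)[OF assms(3)])
qed

end
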